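(* For each integer $n\ge 1$, let $\sigma_{n,2}$ be the random part size obtained by the following two-step procedure (Procedure 2): first choose a partition $\lambda$ of $n$ uniformly at random among all $p(n)$ partitions of $n$; then, given $\lambda$, choose a part size with probability proportional to the product of its size and its multiplicity in $\lambda$, i.e. the part size $j$ is selected with probability $j m_j/n$, where $m_j$ is the multiplicity of $j$ in $\lambda$. Then for every real $t$ with $0<t<\infty$, $$\lim_{n\to\infty}\mathbb{P}\left(\frac{\pi\,\sigma_{n,2}}{\sqrt{6n}}\le t\right)=\frac{6}{\pi^2}\int_0^t\frac{u}{e^u-1}\,du.$$
   Context: A partition $\lambda$ of a positive integer $n$ is a representation $n=\sum_{j=1}^n j m_j$ with non-negative integers $m_j$ (the multiplicity of the part size $j$); $\Lambda(n)$ is the finite set of all partitions of $n$ and $p(n)=|\Lambda(n)|$. For $\lambda\in\Lambda(n)$ let $\alpha_j^{(n)}(\lambda)=m_j$. For real $s\ge 1$ let $X_{s,n}(\lambda)=\sum_{1\le j\le s} j\,\alpha_j^{(n)}(\lambda)$ if $s\le n$ and $X_{s,n}(\lambda)=n$ if $s>n$. Here $\mathbb{P}$ is the probability measure of the two-step experiment: a pair (partition $\lambda$, selected part size $j$) has probability $\frac{1}{p(n)}\cdot\frac{j\,\alpha_j^{(n)}(\lambda)}{n}$. Equivalently, for $s\ge 1$, $$\mathbb{P}(\sigma_{n,2}\le s)=\frac{1}{p(n)}\sum_{\lambda\in\Lambda(n)}\frac{X_{s,n}(\lambda)}{n}.$$ *)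

theory Defs
  imports "HOL-Probability.Probability"
begin

text \<open>
  A partition of \<open>n\<close> is represented by its multiplicity function: \<open>m j\<close> is the number of
  parts of size \<open>j\<close>. Requiring \<open>m\<close> to vanish outside \<open>{1..n}\<close> makes the representation unique.
\<close>

definition partitions :: "nat \<Rightarrow> (nat \<Rightarrow> nat) set" where
  "partitions n = {m. (\<forall>j. j \<notin> {1..n} \<longrightarrow> m j = 0) \<and> (\<Sum>j=1..n. j * m j) = n}"

definition size_biased_part :: "nat \<Rightarrow> (nat \<Rightarrow> nat) \<Rightarrow> nat pmf" where
  "size_biased_part n m = embed_pmf (\<lambda>j. real (j * m j) / real n)"

text \<open>The joint law of the chosen partition and the part size then selected from it.\<close>

definition procedure2 :: "nat \<Rightarrow> ((nat \<Rightarrow> nat) \<times> nat) pmf" where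
  "procedure2 n =
     do {
       m \<leftarrow> pmf_of_set (partitions n);
       j \<leftarrow> size_biased_part n m;
       return_pmf (m, j)
     }"

definition sigma2 :: "(nat \<Rightarrow> nat) \<times> nat \<Rightarrow> nat" where
  "sigma2 = snd"

text \<open>
  The functions \<open>pmf_of_set\<close> and \<open>embed_pmf\<close> are meaningful only for finite nonempty sets and
  for genuine probability mass functions, respectively; the next facts establish this.
\<close>

lemma finite_partitions: "finite (partitions n)"
proof (rule finite_subset)
  show "partitions n \<subseteq> {m. \<forall>j. (j \<in> {1..n} \<longrightarrow> m j \<in> {0..n}) \<and> (j \<notin> {1..n} \<longrightarrow> m j = 0)}"
  proof
    fix m assume m: "m \<in> partitions n"
    have "m j \<le> n" if j: "j \<in> {1..n}" for j
    proof -
      have "m j \<le> j * m j" using j by simp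
      also have "\<dots> \<le> (\<Sum>j=1..n. j * m j)"
        using j by (intro member_le_sum) auto
      also have "\<dots> = n" using m by (simp add: partitions_def)
      finally show ?thesis .
    qed
    then show "m \<in> {m. \<forall>j. (j \<in> {1..n} \<longrightarrow> m j \<in> {0..n}) \<and> (j \<notin> {1..n} \<longrightarrow> m j = 0)}"
      using m by (auto simp: partitions_def)
  qed
  show "finite {m. \<forall>j. (j \<in> {1..n} \<longrightarrow> m j \<in> {0..n}) \<and> (j \<notin> {1..n} \<longrightarrow> m j = (0::nat))}"
    by (rule finite_set_of_finite_funs) auto
qed

lemma partitions_nonempty: "partitions n \<noteq> {}"
proof -
  have "(\<lambda>j. if j = n \<and> n \<noteq> 0 then 1 else 0) \<in> partitions n"
    by (auto simp: partitions_def if_distrib cong: if_cong)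
  then show ?thesis by blast
qed

lemma pmf_size_biased_part:
  assumes "n \<ge> 1" and m: "m \<in> partitions n"
  shows "pmf (size_biased_part n m) j = real (j * m j) / real n"
  unfolding size_biased_part_def
proof (rule pmf_embed_pmf)
  have "(\<integral>\<^sup>+x. ennreal (real (x * m x) / real n) \<partial>count_space UNIV)
      = (\<Sum>x=1..n. ennreal (real (x * m x) / real n))"
    using m by (intro nn_integral_count_space') (auto simp: partitions_def)
  also have "\<dots> = ennreal (real (\<Sum>x=1..n. x * m x) / real n)"
    by (simp add: sum_ennreal flip: sum_divide_distrib)
  also have "\<dots> = 1"
    using m assms(1) by (simp add: partitions_def)
  finally show "(\<integral>\<^sup>+x. ennreal (real (x * m x) / real n) \<partial>count_space UNIV) = 1" .
qed simp

lemma pmf_procedure2: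
  assumes "n \<ge> 1" and m: "m \<in> partitions n"
  shows "pmf (procedure2 n) (m, j) = 1 / real (card (partitions n)) * (real (j * m j) / real n)"
proof -
  have *: "pmf (size_biased_part n m' \<bind> (\<lambda>j. return_pmf (m', j))) (m, j)
      = (if m' = m then pmf (size_biased_part n m) j else 0)" for m'
  proof -
    have "size_biased_part n m' \<bind> (\<lambda>j. return_pmf (m', j))
        = map_pmf (Pair m') (size_biased_part n m')"
      by (simp add: map_pmf_def)
    moreover have "pmf (map_pmf (Pair m') (size_biased_part n m')) (m, j) = 0" if "m' \<noteq> m"
      using that by (intro pmf_map_outside) auto
    ultimately show ?thesis
      by (auto simp: pmf_map_inj' inj_on_def)
  qed
  show ?thesis
    unfolding procedure2_def
    using finite_partitions[of n] partitions_nonempty[of n] m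
    by (subst pmf_bind, simp only: *, subst integral_pmf_of_set)
      (auto simp: pmf_size_biased_part[OF assms])
qed

end

theory Submission
  imports Defs "HOL-Real_Asymp.Real_Asymp"
begin

text \<open>
  Write \<open>c = pi / sqrt 6\<close> and give a multiplicity function \<open>m\<close> on \<open>{1..n}\<close> the Boltzmann weight
  \<open>exp (- (\<Sum>j. a j * m j))\<close>; its partition function is \<open>exp (\<Sum>j. bose (a j))\<close> with
  \<open>bose y = - ln (1 - exp (- y))\<close>, and \<open>(\<Sum>j. bose (x * j / sqrt n)) / sqrt n\<close> tends to
  \<open>c\<^sup>2 / x\<close>. Exponential tilting with \<open>x\<close> slightly above \<open>c\<close> gives the crude bound
  \<open>ln (p n) \<ge> (2 * c - o(1)) * sqrt n\<close> for the number \<open>p n\<close> of partitions, which replaces the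
  Hardy-Ramanujan formula. Let \<open>X m\<close> be the total
  size of the parts of size at most \<open>s = S * sqrt n\<close>. Lowering the weight exponents from
  \<open>c * j / sqrt n\<close> to \<open>(c - \<eta>) * j / sqrt n\<close> for \<open>j \<le> s\<close> bounds the exponential moment of
  \<open>\<eta> * X / sqrt n\<close> over the partitions of \<open>n\<close>, so Jensen's inequality and the convexity of \<open>bose\<close> yield
  \<open>\<eta> * mean (X / n) \<le> o(1) + \<eta> * R\<close>, where \<open>R\<close> is a Riemann sum of \<open>u / (exp u - 1)\<close>. Small
  \<open>\<eta>\<close> of either sign give the matching upper and lower bounds.
\<close>

subsection \<open>Asymptotics of the log partition function\<close>

text \<open>For \<open>y > 0\<close>, \<open>exp (bose y)\<close> is the geometric series of
  \<open>exp (- (m * y))\<close> over all multiplicities \<open>m\<close>, so \<open>bose\<close> is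
  the log partition function of a single part size.\<close>

definition bose :: "real \<Rightarrow> real" where
  "bose y = - ln (1 - exp (- y))"

definition bose_sum :: "nat \<Rightarrow> real \<Rightarrow> real" where
  "bose_sum n x = (\<Sum>j=1..n. bose (x * real j / sqrt (real n)))"

lemma exp_neg_bose: "y > 0 \<Longrightarrow> exp (- bose y) = 1 - exp (- y)"
  by (simp add: bose_def)

lemma bose_sums:
  assumes "y > 0"
  shows "(\<lambda>k. exp (- (real (Suc k) * y)) / real (Suc k)) sums bose y"
proof -
  have "(\<lambda>k. - ((exp (- y)) ^ k) / of_nat k) sums ln (1 - exp (- y))"
    using ln_series'[of "- exp (- y)"] assms by simp
  from sums_minus[OF this] have "(\<lambda>k. exp (- y) ^ k / real k) sums bose y"
    by (simp add: bose_def)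
  \<comment> \<open>The term at index 0 is a division by zero and hence 0, so the shift of index
    changes no sum.\<close>
  then have "(\<lambda>k. exp (- y) ^ Suc k / real (Suc k)) sums bose y"
    by (subst sums_Suc_iff) simp
  then show ?thesis
    by (simp only: exp_of_nat_mult[symmetric] mult_minus_right)
qed

text \<open>Tangent line of the convex function \<open>bose\<close> at \<open>a\<close>, where its
  slope is \<open>- 1 / (exp a - 1)\<close>. It follows from \<open>ln u \<le> u - 1\<close> and
  \<open>1 + v \<le> exp v\<close>, and the sign of \<open>b - a\<close> is free, so tilts in both
  directions are covered.\<close>

lemma bose_diff_le:
  assumes "a > 0" "b > 0"
  shows "bose a - bose b \<le> (b - a) / (exp a - 1)"
proof -
  have p: "1 - exp (- a) > 0" "1 - exp (- b) > 0" "exp a > 1" using assms by auto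
  have "bose a - bose b = ln ((1 - exp (- b)) / (1 - exp (- a)))"
    using p by (simp add: bose_def ln_div)
  also have "\<dots> \<le> (1 - exp (- b)) / (1 - exp (- a)) - 1"
    using p by (intro ln_le_minus_one) auto
  also have "\<dots> = (1 - exp (- (b - a))) / (exp a - 1)"
  proof -
    have "exp (- b) = exp (- (b - a)) * exp (- a)" by (simp flip: exp_add)
    moreover have "exp a * exp (- a) = 1" by (simp flip: exp_add)
    ultimately show ?thesis using p by (simp add: field_simps)
  qed
  also have "\<dots> \<le> (b - a) / (exp a - 1)"
  proof (rule divide_right_mono)
    show "1 - exp (- (b - a)) \<le> b - a"
      using exp_ge_add_one_self[of "- (b - a)"] by linarith
  qed (use p in auto)
  finally show ?thesis .
qed

lemma sum_exp_neg_multiples: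
  assumes "z > 0"
  shows "(\<Sum>j=1..n. exp (- (z * real j))) = (1 - exp (- (z * real n))) / (exp z - 1)"
proof (induction n)
  case (Suc n)
  have "exp (- (z * real n)) = exp z * exp (- (z * real (Suc n)))"
    by (simp add: algebra_simps flip: exp_add)
  moreover have "exp z > 1" using assms by simp
  ultimately show ?case using Suc by (simp add: field_simps)
qed simp

text \<open>Expanding the logarithm and exchanging the sums turns the limit into \<open>\<zeta>(2)\<close>.\<close>

lemma sum_bose_sums:
  assumes "d > 0"
  shows "(\<lambda>k. (1 - exp (- (real (Suc k) * d * real n))) /
             (real (Suc k) * (exp (real (Suc k) * d) - 1)))
         sums (\<Sum>j=1..n. bose (d * real j))"
proof -
  have "(\<lambda>k. \<Sum>j=1..n. exp (- (real (Suc k) * (d * real j))) / real (Suc k))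
      sums (\<Sum>j=1..n. bose (d * real j))"
    using assms by (intro sums_sum bose_sums) auto
  also have "(\<lambda>k. \<Sum>j=1..n. exp (- (real (Suc k) * (d * real j))) / real (Suc k)) =
    (\<lambda>k. (\<Sum>j=1..n. exp (- ((real (Suc k) * d) * real j))) / real (Suc k))"
    by (simp only: sum_divide_distrib mult.assoc)
  also have "\<dots> = (\<lambda>k. (1 - exp (- (real (Suc k) * d * real n))) /
             (real (Suc k) * (exp (real (Suc k) * d) - 1)))"
    using assms by (intro ext, subst sum_exp_neg_multiples) (auto simp: mult.commute)
  finally show ?thesis .
qed

lemma inverse_squares_sums_Suc: "(\<lambda>k. 1 / (real (Suc k))\<^sup>2) sums (pi\<^sup>2 / 6)"
  using inverse_squares_sums by (simp add: add.commute)

text \<open>In the series of \<open>sum_bose_sums\<close> every numerator is at most 1 and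
  \<open>exp v - 1 \<ge> v\<close>, which gives a termwise comparison with the series of inverse
  squares. The bound has no error term and holds for each \<open>n \<ge> 1\<close>.\<close>

lemma bose_sum_le:
  assumes "x > 0" "n \<ge> 1"
  shows "bose_sum n x \<le> sqrt (real n) * (pi\<^sup>2 / 6 / x)"
proof -
  define d where "d = x / sqrt (real n)"
  have d: "d > 0" using assms by (simp add: d_def)
  have eq: "bose_sum n x = (\<Sum>j=1..n. bose (d * real j))"
    by (simp add: bose_sum_def d_def)
  have "(\<lambda>k. 1 / d * (1 / (real (Suc k))\<^sup>2)) sums (1 / d * (pi\<^sup>2 / 6))"
    by (intro sums_mult inverse_squares_sums_Suc)
  then have "(\<Sum>j=1..n. bose (d * real j)) \<le> 1 / d * (pi\<^sup>2 / 6)"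
  proof (rule sums_le[OF _ sum_bose_sums[OF d], rotated])
    fix k
    have p: "real (Suc k) * d > 0" using d by simp
    have e: "real (Suc k) * d \<le> exp (real (Suc k) * d) - 1"
      using exp_ge_add_one_self[of "real (Suc k) * d"] by linarith
    have "(1 - exp (- (real (Suc k) * d * real n))) / (real (Suc k) * (exp (real (Suc k) * d) - 1))
       \<le> 1 / (real (Suc k) * (real (Suc k) * d))"
      using p e d by (intro frac_le mult_left_mono mult_pos_pos) auto
    then show "(1 - exp (- (real (Suc k) * d * real n))) / (real (Suc k) * (exp (real (Suc k) * d) - 1))
       \<le> 1 / d * (1 / (real (Suc k))\<^sup>2)"
      by (simp add: power2_eq_square field_simps)
  qed
  then show ?thesis by (simp add: eq d_def field_simps)
qed

text \<open>The upper bound is \<open>bose_sum_le\<close>. For the lower bound the series of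
  nonnegative terms is cut after \<open>K\<close> terms, and the limit is taken in each of these
  finitely many terms.\<close>

lemma bose_sum_asymp:
  assumes "x > 0"
  shows "(\<lambda>n. bose_sum n x / sqrt (real n)) \<longlonglongrightarrow> pi\<^sup>2 / 6 / x"
proof (rule LIMSEQ_I)
  fix e :: real assume e: "e > 0"
  have "(\<lambda>K. \<Sum>k<K. 1 / (real (Suc k))\<^sup>2) \<longlonglongrightarrow> pi\<^sup>2 / 6"
    using inverse_squares_sums_Suc by (simp add: sums_def)
  then have "(\<lambda>K. (\<Sum>k<K. 1 / (real (Suc k))\<^sup>2) / x) \<longlonglongrightarrow> pi\<^sup>2 / 6 / x"
    using assms by (intro tendsto_intros) auto
  then have "eventually (\<lambda>K. (\<Sum>k<K. 1 / (real (Suc k))\<^sup>2) / x > pi\<^sup>2 / 6 / x - e) sequentially"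
    using e by (intro order_tendstoD) auto
  then obtain K where K: "(\<Sum>k<K. 1 / (real (Suc k))\<^sup>2) / x > pi\<^sup>2 / 6 / x - e"
    by (auto simp: eventually_sequentially)
  define T where "T n k = (1 - exp (- (real (Suc k) * (x / sqrt (real n)) * real n))) /
             (real (Suc k) * (exp (real (Suc k) * (x / sqrt (real n))) - 1))" for n k
  \<comment> \<open>With \<open>d = x / sqrt n\<close>, the quantity \<open>Suc k * d\<close> tends
    to 0 while \<open>Suc k * d * n\<close> tends to infinity: the numerator tends to 1 and
    \<open>exp v - 1\<close> behaves like \<open>v\<close>.\<close>
  have lim: "(\<lambda>n. T n k / sqrt (real n)) \<longlonglongrightarrow> 1 / (real (Suc k))\<^sup>2 / x" for k
  proof -
    define a where "a = real (Suc k)"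
    have a: "a > 0" by (simp add: a_def)
    have "(\<lambda>n. (1 - exp (- (a * (x / sqrt (real n)) * real n))) /
             (a * (exp (a * (x / sqrt (real n))) - 1)) / sqrt (real n)) \<longlonglongrightarrow> 1 / a\<^sup>2 / x"
      using a assms by (real_asymp simp: field_simps power2_eq_square)
    then show ?thesis unfolding T_def a_def .
  qed
  have "(\<lambda>n. (\<Sum>k<K. T n k / sqrt (real n))) \<longlonglongrightarrow> (\<Sum>k<K. 1 / (real (Suc k))\<^sup>2 / x)"
    by (intro tendsto_sum lim)
  then have "eventually (\<lambda>n. (\<Sum>k<K. T n k / sqrt (real n)) > pi\<^sup>2 / 6 / x - e) sequentially"
    using K by (intro order_tendstoD) (auto simp: sum_divide_distrib)
  then have "eventually (\<lambda>n. norm (bose_sum n x / sqrt (real n) - pi\<^sup>2 / 6 / x) < e) sequentially"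
    using eventually_ge_at_top[of 1]
  proof eventually_elim
    case (elim n)
    have d: "x / sqrt (real n) > 0" using assms elim by simp
    have T: "T n sums bose_sum n x"
      using sum_bose_sums[OF d, of n] by (simp add: T_def[abs_def] bose_sum_def)
    have "(\<Sum>k<K. T n k) \<le> bose_sum n x"
      unfolding sums_unique[OF T]
    proof (rule sum_le_suminf)
      show "summable (T n)" using T by (rule sums_summable)
      show "0 \<le> T n k" for k
        unfolding T_def using assms by (intro divide_nonneg_nonneg mult_nonneg_nonneg) auto
    qed auto
    then have "(\<Sum>k<K. T n k) / sqrt (real n) \<le> bose_sum n x / sqrt (real n)"
      using elim by (intro divide_right_mono) auto
    moreover have "bose_sum n x / sqrt (real n) \<le> pi\<^sup>2 / 6 / x"
      using bose_sum_le[OF assms elim(2)] elim by (simp add: field_simps)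
    ultimately show ?case using elim e by (simp add: sum_divide_distrib abs_if)
  qed
  then show "\<exists>no. \<forall>n\<ge>no. norm (bose_sum n x / sqrt (real n) - pi\<^sup>2 / 6 / x) < e"
    by (simp add: eventually_sequentially)
qed

subsection \<open>Riemann sums\<close>

text \<open>The value 1 at 0 is the continuous extension; the bare quotient would be 0 there by the
  convention for division by zero.\<close>

definition bose_kernel :: "real \<Rightarrow> real" where
  "bose_kernel u = (if u = 0 then 1 else u / (exp u - 1))"

lemma continuous_on_bose_kernel: "continuous_on A bose_kernel"
proof (rule continuous_on_subset[of UNIV])
  have "isCont bose_kernel u" for u
  proof (cases "u = 0")
    case True
    have "((\<lambda>u::real. u / (exp u - 1)) \<longlongrightarrow> 1) (at 0)" by real_asymp
    then have "(bose_kernel \<longlongrightarrow> 1) (at 0)"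
      by (rule Lim_transform_eventually) (auto simp: bose_kernel_def eventually_at_filter)
    then show ?thesis using True by (simp add: isCont_def bose_kernel_def)
  next
    case False
    then have "isCont (\<lambda>u::real. u / (exp u - 1)) u" by (intro continuous_intros) auto
    moreover have "eventually (\<lambda>v. v \<noteq> 0) (nhds u)"
      using False by (intro t1_space_nhds) auto
    then have "eventually (\<lambda>v. bose_kernel v = v / (exp v - 1)) (nhds u)"
      by eventually_elim (simp add: bose_kernel_def)
    ultimately show ?thesis by (simp add: isCont_cong)
  qed
  then show "continuous_on UNIV bose_kernel" by (simp add: continuous_at_imp_continuous_on)
qed auto

lemma bose_kernel_antimono:
  assumes "0 \<le> u" "u \<le> v"
  shows "bose_kernel v \<le> bose_kernel u"
proof (cases "u = 0")
  case True
  have "v \<le> exp v - 1" using exp_ge_add_one_self[of v] by linarith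
  then show ?thesis
    using assms True by (auto simp: bose_kernel_def divide_le_eq_1)
next
  case False
  then have p: "u > 0" "v > 0" using assms by auto
  \<comment> \<open>On \<open>{0..v}\<close> the exponential lies below its chord, so
    \<open>(exp u - 1) / u\<close> grows with \<open>u\<close>.\<close>
  have "exp ((1 - u / v) *\<^sub>R 0 + (u / v) *\<^sub>R v) \<le> (1 - u / v) * exp 0 + (u / v) * exp v"
    by (rule convex_onD[OF exp_convex]) (use p assms in auto)
  then have "exp u - 1 \<le> (u / v) * (exp v - 1)" using p by (simp add: algebra_simps)
  then have "v * (exp u - 1) \<le> u * (exp v - 1)" using p by (simp add: field_simps)
  then show ?thesis using p by (simp add: bose_kernel_def field_simps)
qed

lemma bose_kernel_le_1: "0 \<le> u \<Longrightarrow> bose_kernel u \<le> 1"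
  using bose_kernel_antimono[of 0 u] by (simp add: bose_kernel_def)

lemma bose_kernel_nonneg: "0 \<le> u \<Longrightarrow> 0 \<le> bose_kernel u"
  by (simp add: bose_kernel_def)

lemma bose_kernel_integrable: "bose_kernel integrable_on {a..b}"
  by (intro integrable_continuous_real continuous_on_bose_kernel)

lemma integral_bose_kernel:
  "integral {0..b} bose_kernel = integral {0..b} (\<lambda>u. u / (exp u - 1))"
  by (rule integral_spike[of "{0}"]) (auto simp: bose_kernel_def)

text \<open>Since the kernel decreases, a sum over right endpoints lies below the integral over its
  own cells and above the integral over the cells moved one step to the right.\<close>

lemma riemann_sum_bose_kernel:
  assumes "d \<ge> 0"
  shows "d * (\<Sum>j=1..N. bose_kernel (real j * d)) \<le> integral {0..real N * d} bose_kernel"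
    and "integral {d..real (Suc N) * d} bose_kernel \<le> d * (\<Sum>j=1..N. bose_kernel (real j * d))"
proof -
  have step: "integral {x..x + d} bose_kernel \<in> {d * bose_kernel (x + d)..d * bose_kernel x}"
    if "x \<ge> 0" for x
  proof -
    have "integral {x..x + d} (\<lambda>_. bose_kernel (x + d)) \<le> integral {x..x + d} bose_kernel"
      using that assms
      by (intro integral_le bose_kernel_integrable integrable_const_ivl bose_kernel_antimono) auto
    moreover have "integral {x..x + d} bose_kernel \<le> integral {x..x + d} (\<lambda>_. bose_kernel x)"
      using that assms
      by (intro integral_le bose_kernel_integrable integrable_const_ivl bose_kernel_antimono) auto
    ultimately show ?thesis using assms by simp
  qed
  show "d * (\<Sum>j=1..N. bose_kernel (real j * d)) \<le> integral {0..real N * d} bose_kernel"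
  proof (induction N)
    case (Suc N)
    have "integral {0..real N * d} bose_kernel + integral {real N * d..real N * d + d} bose_kernel
        = integral {0..real N * d + d} bose_kernel"
      using assms by (intro Henstock_Kurzweil_Integration.integral_combine bose_kernel_integrable) auto
    then show ?case using Suc step[of "real N * d"] assms by (simp add: algebra_simps)
  qed simp
  show "integral {d..real (Suc N) * d} bose_kernel \<le> d * (\<Sum>j=1..N. bose_kernel (real j * d))"
  proof (induction N)
    case (Suc N)
    have "integral {d..real (Suc N) * d} bose_kernel
        + integral {real (Suc N) * d..real (Suc N) * d + d} bose_kernel
        = integral {d..real (Suc N) * d + d} bose_kernel"
      using assms by (intro Henstock_Kurzweil_Integration.integral_combine bose_kernel_integrable)
        (auto simp: algebra_simps)
    then show ?case using Suc step[of "real (Suc N) * d"] assms by (simp add: algebra_simps)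
  qed simp
qed

text \<open>With mesh \<open>d = x / sqrt n\<close> and nodes \<open>j * d\<close>, the summand
  equals \<open>d * bose_kernel (j * d) / x\<^sup>2\<close>, because
  \<open>d\<^sup>2 / x\<^sup>2 = 1 / n\<close>. Monotonicity keeps the error within one
  cell.\<close>

lemma riemann_sum_asymp:
  assumes "x > 0" "S > 0"
  shows "(\<lambda>n. (\<Sum>j | j \<in> {1..n} \<and> real j \<le> S * sqrt (real n).
                real j / (exp (x * real j / sqrt (real n)) - 1)) / real n)
         \<longlonglongrightarrow> integral {0..x * S} bose_kernel / x\<^sup>2"
    (is "?R \<longlonglongrightarrow> ?I / _")
proof -
  have bound: "eventually (\<lambda>n. ?R n \<in> {(?I - x / sqrt (real n)) / x\<^sup>2..?I / x\<^sup>2}) sequentially"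
  proof -
    \<comment> \<open>From here on the cutoff lies below \<open>n\<close>, so the condition
      \<open>j \<in> {1..n}\<close> cuts nothing off at the top.\<close>
    have "eventually (\<lambda>n. S * sqrt (real n) \<le> real n) sequentially" by real_asymp
    then show ?thesis using eventually_ge_at_top[of 1]
    proof eventually_elim
      case (elim n)
      define d where "d = x / sqrt (real n)"
      define N where "N = nat \<lfloor>S * sqrt (real n)\<rfloor>"
      have d: "d > 0" using assms elim by (simp add: d_def)
      have N: "real N \<le> S * sqrt (real n)" "S * sqrt (real n) < real (Suc N)"
        using assms unfolding N_def by (auto simp: of_nat_nat) linarith+
      have iff: "real j \<le> S * sqrt (real n) \<longleftrightarrow> j \<le> N" for j
        unfolding N_def using assms by (simp add: le_nat_iff le_floor_iff)
      have "N \<le> n" using N(1) elim by linarith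
      then have J: "{j. j \<in> {1..n} \<and> real j \<le> S * sqrt (real n)} = {1..N}"
        by (auto simp: iff)
      have "real j / (exp (x * real j / sqrt (real n)) - 1) / real n = d * bose_kernel (real j * d) / x\<^sup>2"
        if "j \<in> {1..N}" for j
      proof -
        have jd: "x * real j / sqrt (real n) = real j * d" by (simp add: d_def)
        have "d * (real j * d) / x\<^sup>2 = real j / real n"
          using assms elim by (simp add: d_def power2_eq_square field_simps)
        moreover have "bose_kernel (real j * d) = real j * d / (exp (real j * d) - 1)"
          using d that by (simp add: bose_kernel_def)
        ultimately show ?thesis
          unfolding jd by (metis divide_divide_eq_left mult.commute times_divide_eq_right)
      qed
      then have R: "?R n = d * (\<Sum>j=1..N. bose_kernel (real j * d)) / x\<^sup>2"
        unfolding J by (simp add: sum_divide_distrib sum_distrib_left)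
      have xS: "real N * d \<le> x * S" "x * S \<le> real (Suc N) * d"
      proof -
        have eq: "x * S = S * sqrt (real n) * d" using elim by (simp add: d_def)
        show "real N * d \<le> x * S" unfolding eq using N d by (intro mult_right_mono) auto
        show "x * S \<le> real (Suc N) * d" unfolding eq using N d by (intro mult_right_mono) auto
      qed
      have "integral {0..real N * d} bose_kernel \<le> ?I"
        using xS d by (intro integral_subset_le bose_kernel_integrable) (auto simp: bose_kernel_nonneg)
      then have up: "d * (\<Sum>j=1..N. bose_kernel (real j * d)) \<le> ?I"
        using riemann_sum_bose_kernel(1)[of d N] d by linarith
      have "?I \<le> integral {0..real (Suc N) * d} bose_kernel"
        using xS d by (intro integral_subset_le bose_kernel_integrable) (auto simp: bose_kernel_nonneg)
      also have "\<dots> = integral {0..d} bose_kernel + integral {d..real (Suc N) * d} bose_kernel"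
        using d by (intro Henstock_Kurzweil_Integration.integral_combine[symmetric] bose_kernel_integrable)
          (auto simp: algebra_simps)
      \<comment> \<open>The cell at the origin, missing from the lower estimate, costs at most
        \<open>d\<close> because the kernel is at most 1.\<close>
      also have "integral {0..d} bose_kernel \<le> integral {0..d} (\<lambda>_. 1)"
        using d by (intro integral_le bose_kernel_integrable integrable_const_ivl bose_kernel_le_1) auto
      finally have "?I \<le> d + integral {d..real (Suc N) * d} bose_kernel" using d by simp
      then have "?I - d \<le> d * (\<Sum>j=1..N. bose_kernel (real j * d))"
        using riemann_sum_bose_kernel(2)[of d N] d by linarith
      with up show ?case unfolding R d_def[symmetric] by (simp add: divide_right_mono)
    qed
  qed
  have "(\<lambda>n. (?I - x / sqrt (real n)) / x\<^sup>2) \<longlonglongrightarrow> (?I - 0) / x\<^sup>2"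
  proof -
    have "(\<lambda>n. x / sqrt (real n)) \<longlonglongrightarrow> 0" by real_asymp
    then show ?thesis using assms by (intro tendsto_intros) auto
  qed
  then show ?thesis
    using bound by (intro tendsto_sandwich[of "\<lambda>n. (?I - x / sqrt (real n)) / x\<^sup>2" ?R _ "\<lambda>_. ?I / x\<^sup>2"])
      (auto elim: eventually_mono)
qed

lemma isCont_integral_bose_kernel:
  assumes "b > 0"
  shows "isCont (\<lambda>b. integral {0..b} bose_kernel) b"
proof -
  have "continuous_on {0..b + 1} (\<lambda>b. integral {0..b} bose_kernel)"
    by (intro indefinite_integral_continuous_1 bose_kernel_integrable)
  then have "continuous_on {0<..<b + 1} (\<lambda>b. integral {0..b} bose_kernel)"
    by (rule continuous_on_subset) auto
  then show ?thesis using assms by (subst (asm) continuous_on_eq_continuous_at) auto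
qed

subsection \<open>Boltzmann measures on multiplicity functions\<close>

text \<open>Independent geometric multiplicities realise the normalised Boltzmann weight. The
  default value 0 outside \<open>{1..n}\<close> matches the convention of
  \<open>partitions\<close>.\<close>

definition boltzmann :: "nat \<Rightarrow> (nat \<Rightarrow> real) \<Rightarrow> (nat \<Rightarrow> nat) pmf" where
  "boltzmann n a = Pi_pmf {1..n} 0 (\<lambda>j. geometric_pmf (1 - exp (- a j)))"

lemma pmf_boltzmann:
  assumes "\<And>j. j \<in> {1..n} \<Longrightarrow> a j > 0" "\<And>j. j \<notin> {1..n} \<Longrightarrow> m j = 0"
  shows "pmf (boltzmann n a) m = exp (- (\<Sum>j=1..n. a j * real (m j)) - (\<Sum>j=1..n. bose (a j)))"
proof -
  have "pmf (boltzmann n a) m = (\<Prod>j=1..n. pmf (geometric_pmf (1 - exp (- a j))) (m j))"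
    unfolding boltzmann_def using assms(2) by (intro pmf_Pi') auto
  also have "\<dots> = (\<Prod>j=1..n. exp (- (a j * real (m j)) - bose (a j)))"
  proof (rule prod.cong[OF refl])
    fix j assume j: "j \<in> {1..n}"
    have "exp (- a j) ^ m j = exp (- (a j * real (m j)))"
      by (simp add: mult.commute flip: exp_of_nat_mult)
    then show "pmf (geometric_pmf (1 - exp (- a j))) (m j) = exp (- (a j * real (m j)) - bose (a j))"
      using assms(1)[OF j] by (subst pmf_geometric) (auto simp: exp_diff exp_neg_bose exp_minus[of "bose _", symmetric] divide_inverse)
  qed
  also have "\<dots> = exp (\<Sum>j=1..n. - (a j * real (m j)) - bose (a j))"
    by (simp add: exp_sum)
  finally show ?thesis by (simp add: sum_subtractf sum_negf)
qed

lemma set_pmf_boltzmann: "m \<in> set_pmf (boltzmann n a) \<Longrightarrow> j \<notin> {1..n} \<Longrightarrow> m j = 0"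
  using set_Pi_pmf_subset[of "{1..n}" 0] unfolding boltzmann_def by blast

text \<open>Change of measure: the two densities differ by an exponential tilt and a constant factor.\<close>

lemma prob_boltzmann_le:
  assumes a: "\<And>j. j \<in> {1..n} \<Longrightarrow> a j > 0" and b: "\<And>j. j \<in> {1..n} \<Longrightarrow> b j > 0"
    and C: "\<And>m. m \<in> A \<Longrightarrow> (\<Sum>j=1..n. (b j - a j) * real (m j)) \<le> C"
  shows "measure_pmf.prob (boltzmann n a) A
           \<le> exp (C + (\<Sum>j=1..n. bose (b j)) - (\<Sum>j=1..n. bose (a j)))"
    (is "_ \<le> ?K")
proof -
  have le: "pmf (boltzmann n a) m \<le> ?K * pmf (boltzmann n b) m" if "m \<in> A" for m
  proof (cases "\<forall>j. j \<notin> {1..n} \<longrightarrow> m j = 0")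
    case True
    have "(\<Sum>j=1..n. b j * real (m j)) - (\<Sum>j=1..n. a j * real (m j)) \<le> C"
      using C[OF that] by (simp add: algebra_simps sum_subtractf)
    then show ?thesis
      using pmf_boltzmann[of n a m] pmf_boltzmann[of n b m] True a b by (simp flip: exp_add)
  next
    case False
    then show ?thesis by (simp add: boltzmann_def pmf_Pi_outside)
  qed
  have "emeasure (boltzmann n a) A = (\<integral>\<^sup>+m. pmf (boltzmann n a) m \<partial>count_space A)"
    by (simp add: nn_integral_pmf)
  also have "\<dots> \<le> (\<integral>\<^sup>+m. ennreal ?K * pmf (boltzmann n b) m \<partial>count_space A)"
    using le by (intro nn_integral_mono) (auto simp: ennreal_mult[symmetric] intro!: ennreal_leI)
  also have "\<dots> = ennreal ?K * emeasure (boltzmann n b) A"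
    by (subst nn_integral_cmult) (auto simp: nn_integral_pmf)
  also have "\<dots> \<le> ennreal ?K * 1"
    by (intro mult_left_mono measure_pmf.emeasure_le_1) auto
  finally show ?thesis by (simp add: measure_pmf.emeasure_eq_measure)
qed

section \<open>Counting partitions, and the law of the selected part size\<close>

lemma card_partitions_pos: "card (partitions n) > 0"
  using finite_partitions partitions_nonempty by (simp add: card_gt_0_iff)

text \<open>Adding \<open>n - k\<close> parts of size 1 maps partitions of \<open>k\<close>
  injectively to partitions of \<open>n\<close>.\<close>

lemma card_partitions_mono:
  assumes "k \<le> n"
  shows "card (partitions k) \<le> card (partitions n)"
proof (cases "n = 0")
  case True
  then show ?thesis using assms by simp
next
  case False
  define f :: "(nat \<Rightarrow> nat) \<Rightarrow> nat \<Rightarrow> nat" where "f m = m(1 := m 1 + (n - k))" for m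
  have "inj f"
  proof (intro injI ext)
    fix m m' j assume "f m = f m'"
    then have "f m j = f m' j" by simp
    then show "m j = m' j" by (cases "j = 1") (simp_all add: f_def)
  qed
  moreover have "f m \<in> partitions n" if "m \<in> partitions k" for m
  proof -
    have m: "\<And>j. j \<notin> {1..k} \<Longrightarrow> m j = 0" "(\<Sum>j=1..k. j * m j) = k"
      using that by (auto simp: partitions_def)
    have "(\<Sum>j=1..n. j * f m j) = (\<Sum>j=1..n. j * m j + (if j = 1 then n - k else 0))"
      by (intro sum.cong) (auto simp: f_def)
    also have "\<dots> = (\<Sum>j=1..n. j * m j) + (n - k)"
      using False by (simp add: sum.distrib)
    also have "(\<Sum>j=1..n. j * m j) = (\<Sum>j=1..k. j * m j)"
      using assms m by (intro sum.mono_neutral_right) auto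
    finally show ?thesis
      using m assms False by (auto simp: partitions_def f_def)
  qed
  ultimately show ?thesis
    by (intro card_inj_on_le[of f]) (auto simp: finite_partitions intro: inj_on_subset)
qed

text \<open>A part size that occurs contributes at least itself to the total \<open>k\<close>, so no
  part exceeds \<open>k\<close> and the support shrinks from \<open>{1..n}\<close> to
  \<open>{1..k}\<close>.\<close>

lemma mult_functions_in_partitions:
  assumes "\<And>j. j \<notin> {1..n} \<Longrightarrow> m j = 0" "(\<Sum>j=1..n. j * m j) = k" "k \<le> n"
  shows "m \<in> partitions k"
proof -
  have z: "m j = 0" if "j \<notin> {1..k}" for j
  proof (rule ccontr)
    assume "m j \<noteq> 0"
    then have j: "j \<in> {1..n}" by (rule contrapos_np) (rule assms(1))
    have "j \<le> j * m j" using \<open>m j \<noteq> 0\<close> by simp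
    also have "\<dots> \<le> (\<Sum>j=1..n. j * m j)" using j by (intro member_le_sum) auto
    finally have "j \<le> k" by (simp only: assms(2))
    then show False using that j by simp
  qed
  have "(\<Sum>j=1..k. j * m j) = (\<Sum>j=1..n. j * m j)"
    using assms(3) z by (intro sum.mono_neutral_left) auto
  then have "(\<Sum>j=1..k. j * m j) = k" by (simp only: assms(2))
  then show ?thesis using z by (auto simp only: partitions_def)
qed

text \<open>At most \<open>n * card (partitions n)\<close> functions in the support have total size
  below \<open>n\<close>, by monotonicity of the partition numbers, and a total above
  \<open>M\<close> caps the density of each. This is how the number of partitions enters its own
  lower bound.\<close>

lemma prob_boltzmann_middle_le:
  fixes \<beta> M :: real
  assumes "\<beta> > 0"
  shows "measure_pmf.prob (boltzmann n (\<lambda>j. \<beta> * real j))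
           {m. M < real (\<Sum>j=1..n. j * m j) \<and> (\<Sum>j=1..n. j * m j) < n}
         \<le> real n * real (card (partitions n)) * exp (- (\<beta> * M) - (\<Sum>j=1..n. bose (\<beta> * real j)))"
    (is "measure_pmf.prob ?D ?A \<le> _ * exp ?E")
proof -
  define B where "B = (\<Union>k<n. partitions k)"
  have fin: "finite B" by (auto simp: B_def finite_partitions)
  have sub: "?A \<inter> set_pmf ?D \<subseteq> B"
  proof
    fix m assume m: "m \<in> ?A \<inter> set_pmf ?D"
    then have "m \<in> partitions (\<Sum>j=1..n. j * m j)"
      by (intro mult_functions_in_partitions[of n]) (use set_pmf_boltzmann in auto)
    then show "m \<in> B" using m by (auto simp: B_def)
  qed
  have "card B \<le> (\<Sum>k<n. card (partitions k))" unfolding B_def by (intro card_UN_le) auto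
  also have "\<dots> \<le> (\<Sum>k<n. card (partitions n))" by (intro sum_mono card_partitions_mono) auto
  finally have card: "real (card B) \<le> real n * real (card (partitions n))"
    by (simp flip: of_nat_mult)
  have "measure_pmf.prob ?D ?A = measure_pmf.prob ?D (?A \<inter> set_pmf ?D)"
    by (simp add: measure_Int_set_pmf)
  also have "\<dots> = (\<Sum>m\<in>?A \<inter> set_pmf ?D. pmf ?D m)"
    using finite_subset[OF sub fin] by (rule measure_measure_pmf_finite)
  also have "\<dots> \<le> (\<Sum>m\<in>?A \<inter> set_pmf ?D. exp ?E)"
  proof (rule sum_mono)
    fix m assume m: "m \<in> ?A \<inter> set_pmf ?D"
    then have z: "\<And>j. j \<notin> {1..n} \<Longrightarrow> m j = 0"
      using set_pmf_boltzmann by blast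
    have eq: "(\<Sum>j=1..n. \<beta> * real j * real (m j)) = \<beta> * real (\<Sum>j=1..n. j * m j)"
      unfolding of_nat_sum sum_distrib_left by (intro sum.cong) auto
    have "\<beta> * M \<le> \<beta> * real (\<Sum>j=1..n. j * m j)"
      using m assms by (intro mult_left_mono) auto
    then show "pmf ?D m \<le> exp ?E"
      using z assms by (subst pmf_boltzmann) (auto simp only: eq exp_le_cancel_iff, auto)
  qed
  also have "\<dots> = real (card (?A \<inter> set_pmf ?D)) * exp ?E" by simp
  also have "\<dots> \<le> real (card B) * exp ?E"
    using card_mono[OF fin sub] by (intro mult_right_mono) auto
  also have "\<dots> \<le> real n * real (card (partitions n)) * exp ?E"
    using card by (intro mult_right_mono) auto
  finally show ?thesis .
qed

text \<open>Part sizes of multiplicity 0 have no mass, so the event may be replaced by a finite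
  product set, over which the joint density is summed.\<close>

lemma prob_procedure2:
  assumes "n \<ge> 1"
  shows "measure_pmf.prob (procedure2 n) {\<omega>. P (sigma2 \<omega>)} =
     (\<Sum>m\<in>partitions n. real (\<Sum>j | j \<in> {1..n} \<and> P j. j * m j)) / (real n * real (card (partitions n)))"
proof -
  let ?J = "{j. j \<in> {1..n} \<and> P j}"
  have sup: "m \<in> partitions n \<and> j \<in> {1..n}" if "(m, j) \<in> set_pmf (procedure2 n)" for m j
  proof -
    have m: "m \<in> partitions n"
      using that finite_partitions partitions_nonempty by (auto simp: procedure2_def)
    moreover have "real (j * m j) \<noteq> 0"
      using that pmf_procedure2[OF assms m] by (auto simp: set_pmf_iff)
    ultimately show ?thesis by (auto simp: partitions_def)
  qed
  have "measure_pmf.prob (procedure2 n) {\<omega>. P (sigma2 \<omega>)} =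
      measure_pmf.prob (procedure2 n) (partitions n \<times> ?J)"
  proof (rule measure_prob_cong_0)
    fix \<omega> assume "\<omega> \<in> {\<omega>. P (sigma2 \<omega>)} - partitions n \<times> ?J"
    then show "pmf (procedure2 n) \<omega> = 0"
      using sup[of "fst \<omega>" "snd \<omega>"] by (cases \<omega>) (auto simp: sigma2_def set_pmf_iff)
  qed (auto simp: sigma2_def)
  also have "\<dots> = (\<Sum>m\<in>partitions n. \<Sum>j\<in>?J. pmf (procedure2 n) (m, j))"
    by (simp add: measure_measure_pmf_finite finite_partitions sum.cartesian_product)
  also have "\<dots> = (\<Sum>m\<in>partitions n. \<Sum>j\<in>?J. real (j * m j) / (real n * real (card (partitions n))))"
    using pmf_procedure2[OF assms] by (intro sum.cong refl) (simp add: mult.commute)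
  finally show ?thesis by (simp only: sum_divide_distrib of_nat_sum)
qed

subsection \<open>Exponential growth of the number of partitions\<close>

lemma sum_bose_scaled: "(\<Sum>j=1..n. bose (x / sqrt (real n) * real j)) = bose_sum n x"
  by (simp add: bose_sum_def)

text \<open>
  The three summands bound the Boltzmann probabilities at \<open>x\<close> that the total size is at least \<open>n\<close>
  (tilted to \<open>y\<close>), at most \<open>\<mu> * n\<close> (tilted to \<open>z\<close>), or in between.
\<close>

lemma boltzmann_decomposition:
  assumes n: "n \<ge> 1" and xyz: "0 < y" "y < x" "x < z" and "\<mu> \<ge> 0"
  shows "1 \<le> exp (- ((x - y) * sqrt (real n)) + bose_sum n y - bose_sum n x)
    + exp ((z - x) * \<mu> * sqrt (real n) + bose_sum n z - bose_sum n x)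
    + real n * real (card (partitions n)) * exp (- (x * \<mu> * sqrt (real n)) - bose_sum n x)"
proof -
  define r where "r = sqrt (real n)"
  have r: "r > 0" "r * r = real n" using n by (auto simp: r_def)
  let ?S = "\<lambda>m. \<Sum>j=1..n. j * m j"
  let ?D = "boltzmann n (\<lambda>j. x / r * real j)"
  have tilt: "(\<Sum>j=1..n. (w / r * real j - x / r * real j) * real (m j)) = (w - x) / r * real (?S m)"
    for w and m :: "nat \<Rightarrow> nat"
    unfolding of_nat_sum sum_distrib_left
    by (intro sum.cong refl) (simp add: algebra_simps diff_divide_distrib)
  have eq: "x / r * (\<mu> * real n) = x * \<mu> * r"
    using r(1) by (simp flip: r(2))
  have "measure_pmf.prob ?D {m. \<mu> * real n < real (?S m) \<and> ?S m < n}
     \<le> real n * real (card (partitions n)) * exp (- (x / r * (\<mu> * real n)) - (\<Sum>j=1..n. bose (x / r * real j)))"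
    using xyz r by (intro prob_boltzmann_middle_le) auto
  then have "measure_pmf.prob ?D {m. \<mu> * real n < real (?S m) \<and> ?S m < n}
     \<le> real n * real (card (partitions n)) * exp (- (x * \<mu> * r) - (\<Sum>j=1..n. bose (x / r * real j)))"
    by (simp only: eq)
  moreover have "measure_pmf.prob ?D {m. n \<le> ?S m}
     \<le> exp (- ((x - y) * r) + (\<Sum>j=1..n. bose (y / r * real j)) - (\<Sum>j=1..n. bose (x / r * real j)))"
  proof (rule prob_boltzmann_le)
    fix m assume "m \<in> {m. n \<le> ?S m}"
    then have "(x - y) / r * (r * r) \<le> (x - y) / r * real (?S m)"
      using xyz r by (intro mult_left_mono) (auto simp only: mem_Collect_eq of_nat_le_iff, auto)
    moreover have "(x - y) / r * (r * r) = (x - y) * r" using r(1) by simp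
    moreover have "(y - x) / r * real (?S m) = - ((x - y) / r * real (?S m))"
      by (simp only: mult_minus_left[symmetric] minus_divide_left minus_diff_eq)
    ultimately show "(\<Sum>j=1..n. (y / r * real j - x / r * real j) * real (m j)) \<le> - ((x - y) * r)"
      unfolding tilt by linarith
  qed (use xyz r in auto)
  moreover have "measure_pmf.prob ?D {m. real (?S m) \<le> \<mu> * real n}
     \<le> exp ((z - x) * \<mu> * r + (\<Sum>j=1..n. bose (z / r * real j)) - (\<Sum>j=1..n. bose (x / r * real j)))"
  proof (rule prob_boltzmann_le)
    fix m assume "m \<in> {m. real (?S m) \<le> \<mu> * real n}"
    then have "(z - x) / r * real (?S m) \<le> (z - x) / r * (\<mu> * (r * r))"
      using xyz r by (intro mult_left_mono) auto
    also have "\<dots> = (z - x) * \<mu> * r" using r(1) by simp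
    finally show "(\<Sum>j=1..n. (z / r * real j - x / r * real j) * real (m j)) \<le> (z - x) * \<mu> * r"
      unfolding tilt .
  qed (use xyz r in auto)
  moreover have "1 \<le> measure_pmf.prob ?D {m. n \<le> ?S m} + measure_pmf.prob ?D {m. real (?S m) \<le> \<mu> * real n}
      + measure_pmf.prob ?D {m. \<mu> * real n < real (?S m) \<and> ?S m < n}"
  proof -
    let ?A = "{m. n \<le> ?S m}" and ?B = "{m. real (?S m) \<le> \<mu> * real n}"
      and ?C = "{m. \<mu> * real n < real (?S m) \<and> ?S m < n}"
    have "?A \<union> ?B \<union> ?C = UNIV" by (auto simp: not_le)
    then have "1 = measure_pmf.prob ?D (?A \<union> ?B \<union> ?C)" by simp
    also have "\<dots> \<le> measure_pmf.prob ?D (?A \<union> ?B) + measure_pmf.prob ?D ?C"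
      by (intro measure_Un_le) auto
    also have "measure_pmf.prob ?D (?A \<union> ?B) \<le> measure_pmf.prob ?D ?A + measure_pmf.prob ?D ?B"
      by (intro measure_Un_le) auto
    finally show ?thesis by simp
  qed
  ultimately show ?thesis
    unfolding r_def sum_bose_scaled by linarith
qed

lemma exp_sqrt_tendsto_0:
  assumes "a \<longlonglongrightarrow> l" "l < 0"
  shows "(\<lambda>n. exp (sqrt (real n) * a n)) \<longlonglongrightarrow> 0"
proof -
  have "filterlim (\<lambda>n. sqrt (real n)) at_top sequentially" by real_asymp
  then have "filterlim (\<lambda>n. a n * sqrt (real n)) at_bot sequentially"
    by (rule filterlim_tendsto_neg_mult_at_bot[OF assms])
  then show ?thesis by (auto intro!: filterlim_compose[OF exp_at_bot] simp: mult.commute)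
qed

text \<open>The conditions on \<open>x * y\<close> and \<mu> make the exponents of the first two
  terms of \<open>boltzmann_decomposition\<close> negative of order \<open>sqrt n\<close>. The third
  term must then carry at least half the mass, and its logarithm gives the bound.\<close>

lemma ln_card_partitions_ge:
  assumes "0 < y" "y < x" "x < z" "0 \<le> \<mu>" "pi\<^sup>2 / 6 < x * y" "\<mu> < pi\<^sup>2 / 6 / (x * z)"
    and l: "l < x * \<mu> + pi\<^sup>2 / 6 / x"
  shows "eventually (\<lambda>n. ln (real (card (partitions n))) > l * sqrt (real n)) sequentially"
proof -
  have pos: "0 < x" "0 < z" using assms by auto
  define K :: real where "K = pi\<^sup>2 / 6"
  let ?r = "\<lambda>n. sqrt (real n)"
  let ?g = "\<lambda>w n. bose_sum n w / ?r n"
  have g: "?g w \<longlonglongrightarrow> K / w" if "w > 0" for w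
    using bose_sum_asymp[OF that] by (simp add: K_def)
  have "(\<lambda>n. - (x - y) + ?g y n - ?g x n) \<longlonglongrightarrow> - (x - y) + K / y - K / x"
    using assms pos by (intro tendsto_intros g) auto
  moreover have "- (x - y) + K / y - K / x < 0"
  proof -
    have "- (x - y) + K / y - K / x = (x - y) * (K / (x * y) - 1)"
      using assms pos by (simp add: field_simps)
    also have "\<dots> < 0" using assms pos by (intro mult_pos_neg) (auto simp: K_def)
    finally show ?thesis .
  qed
  ultimately have t1: "(\<lambda>n. exp (?r n * (- (x - y) + ?g y n - ?g x n))) \<longlonglongrightarrow> 0"
    by (rule exp_sqrt_tendsto_0)
  have "(\<lambda>n. (z - x) * \<mu> + ?g z n - ?g x n) \<longlonglongrightarrow> (z - x) * \<mu> + K / z - K / x"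
    using assms pos by (intro tendsto_intros g) auto
  moreover have "(z - x) * \<mu> + K / z - K / x < 0"
  proof -
    have "(z - x) * \<mu> + K / z - K / x = (z - x) * (\<mu> - K / (x * z))"
      using assms pos by (simp add: field_simps)
    also have "\<dots> < 0" using assms pos by (intro mult_pos_neg) (auto simp: K_def)
    finally show ?thesis .
  qed
  ultimately have t2: "(\<lambda>n. exp (?r n * ((z - x) * \<mu> + ?g z n - ?g x n))) \<longlonglongrightarrow> 0"
    by (rule exp_sqrt_tendsto_0)
  \<comment> \<open>The correction \<open>ln (2 * n)\<close> absorbs the factor \<open>n\<close> of
    the third term and the 2 from its share of one half; it is negligible against
    \<open>sqrt n\<close>.\<close>
  have "(\<lambda>n. x * \<mu> + ?g x n - ln (2 * real n) / ?r n) \<longlonglongrightarrow> x * \<mu> + K / x - 0"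
  proof -
    have "(\<lambda>n. ln (2 * real n) / ?r n) \<longlonglongrightarrow> 0" by real_asymp
    then show ?thesis using pos by (intro tendsto_intros g) auto
  qed
  then have t3: "eventually (\<lambda>n. x * \<mu> + ?g x n - ln (2 * real n) / ?r n > l) sequentially"
    using l by (intro order_tendstoD(1)) (auto simp: K_def)
  have "eventually (\<lambda>n. exp (?r n * (- (x - y) + ?g y n - ?g x n)) < 1 / 4) sequentially"
    and "eventually (\<lambda>n. exp (?r n * ((z - x) * \<mu> + ?g z n - ?g x n)) < 1 / 4) sequentially"
    using order_tendstoD(2)[OF t1, of "1 / 4"] order_tendstoD(2)[OF t2, of "1 / 4"] by simp_all
  then show ?thesis using t3 eventually_ge_at_top[of 1]
  proof eventually_elim
    case (elim n)
    define p where "p = real (card (partitions n))"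
    have p: "p > 0" by (simp add: p_def card_partitions_pos)
    have r: "?r n > 0" and n: "real n > 0" using elim by auto
    have g_r: "?r n * ?g w n = bose_sum n w" for w using r by simp
    have eqs: "- ((x - y) * ?r n) + bose_sum n y - bose_sum n x = ?r n * (- (x - y) + ?g y n - ?g x n)"
      "(z - x) * \<mu> * ?r n + bose_sum n z - bose_sum n x = ?r n * ((z - x) * \<mu> + ?g z n - ?g x n)"
      "- (x * \<mu> * ?r n) - bose_sum n x = - (?r n * (x * \<mu> + ?g x n))"
      unfolding distrib_left right_diff_distrib g_r by (simp_all add: algebra_simps)
    have "1 / 2 < real n * p * exp (- (?r n * (x * \<mu> + ?g x n)))"
      using boltzmann_decomposition[OF elim(4) assms(1-4)] elim(1,2)
      unfolding p_def eqs by linarith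
    then have "exp (?r n * (x * \<mu> + ?g x n)) < 2 * real n * p"
      unfolding exp_minus by (simp only: divide_inverse[symmetric]) (simp add: pos_less_divide_eq)
    then have "ln (exp (?r n * (x * \<mu> + ?g x n))) < ln (2 * real n * p)"
      using p n by (subst ln_less_cancel_iff) auto
    also have "\<dots> = ln (2 * real n) + ln p"
      using p n by (subst ln_mult) auto
    finally have "?r n * (x * \<mu> + ?g x n) < ln (2 * real n) + ln p"
      by (simp only: ln_exp)
    then have "?r n * (x * \<mu> + ?g x n - ln (2 * real n) / ?r n) < ln p"
      using r by (simp add: algebra_simps)
    moreover have "?r n * l < ?r n * (x * \<mu> + ?g x n - ln (2 * real n) / ?r n)"
      using elim r by (intro mult_strict_left_mono)
    ultimately show ?case by (simp add: p_def mult.commute)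
  qed
qed

text \<open>The tilts are \<open>y = c\<close>, \<open>x = (1 + d) * c\<close> and
  \<open>z = (1 + 2 * d) * c\<close>, with \<mu> equal to \<open>1 / (1 + 2 * d)\<^sup>2\<close>,
  just below the admissible \<open>1 / ((1 + d) * (1 + 2 * d))\<close>. As \<open>d\<close>
  decreases to 0 the constant obtained tends to \<open>2 * c\<close>.\<close>

lemma card_partitions_lower_bound:
  assumes l: "l < 2 * (pi / sqrt 6)"
  shows "eventually (\<lambda>n. ln (real (card (partitions n))) > l * sqrt (real n)) sequentially"
proof -
  define c where "c = pi / sqrt 6"
  have c: "c > 0" "pi\<^sup>2 / 6 = c\<^sup>2" by (auto simp: c_def power_divide)
  have "((\<lambda>d. (1 + d) * c / (1 + 2 * d)\<^sup>2 + c / (1 + d)) \<longlongrightarrow> (1 + 0) * c / (1 + 2 * 0)\<^sup>2 + c / (1 + 0)) (at_right 0)"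
    by (intro tendsto_intros) auto
  then have "eventually (\<lambda>d. (1 + d) * c / (1 + 2 * d)\<^sup>2 + c / (1 + d) > l) (at_right 0)"
    using l by (intro order_tendstoD(1)) (auto simp: c_def)
  then have "eventually (\<lambda>d. d > 0 \<and> (1 + d) * c / (1 + 2 * d)\<^sup>2 + c / (1 + d) > l) (at_right 0)"
    by (intro eventually_conj eventually_at_right_less)
  from eventually_happens[OF this]
  obtain d where d: "d > 0" "(1 + d) * c / (1 + 2 * d)\<^sup>2 + c / (1 + d) > l"
    by auto
  show ?thesis
  proof (rule ln_card_partitions_ge[of c "(1 + d) * c" "(1 + 2 * d) * c" "1 / (1 + 2 * d)\<^sup>2"])
    have "(1 + d) * c * ((1 + 2 * d) * c) = c\<^sup>2 * ((1 + d) * (1 + 2 * d))"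
      by (simp add: power2_eq_square)
    then have "c\<^sup>2 / ((1 + d) * c * ((1 + 2 * d) * c)) = c\<^sup>2 / (c\<^sup>2 * ((1 + d) * (1 + 2 * d)))"
      by (simp only:)
    also have "\<dots> = 1 / ((1 + d) * (1 + 2 * d))" using c(1) by simp
    also have "\<dots> > 1 / (1 + 2 * d)\<^sup>2"
      unfolding power2_eq_square using d
      by (intro divide_strict_left_mono mult_strict_right_mono mult_pos_pos) auto
    finally show "1 / (1 + 2 * d)\<^sup>2 < pi\<^sup>2 / 6 / ((1 + d) * c * ((1 + 2 * d) * c))"
      by (simp add: c)
    have "c\<^sup>2 / ((1 + d) * c) = c / (1 + d)" using c d by (simp add: power2_eq_square)
    then show "l < (1 + d) * c * (1 / (1 + 2 * d)\<^sup>2) + pi\<^sup>2 / 6 / ((1 + d) * c)"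
      using d by (simp add: c)
    show "pi\<^sup>2 / 6 < (1 + d) * c * c" using c d by (simp add: power2_eq_square)
  qed (use c d in auto)
qed

subsection \<open>The mean size carried by small parts\<close>

text \<open>Each exponential is bounded below by its tangent at the mean; the linear terms cancel in
  the sum.\<close>

lemma jensen_exp_sum:
  fixes g :: "'a \<Rightarrow> real"
  assumes "finite A" "A \<noteq> {}"
  shows "real (card A) * exp ((\<Sum>a\<in>A. g a) / real (card A)) \<le> (\<Sum>a\<in>A. exp (g a))"
proof -
  define \<mu> where "\<mu> = (\<Sum>a\<in>A. g a) / real (card A)"
  have "card A > 0" using assms by (simp add: card_gt_0_iff)
  then have "real (card A) * exp \<mu> = (\<Sum>a\<in>A. exp \<mu> * (1 + (g a - \<mu>)))"
    by (simp add: sum.distrib sum_subtractf \<mu>_def flip: sum_distrib_left)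
  also have "\<dots> \<le> (\<Sum>a\<in>A. exp \<mu> * exp (g a - \<mu>))"
    by (intro sum_mono mult_left_mono exp_ge_add_one_self) auto
  also have "\<dots> = (\<Sum>a\<in>A. exp (g a))" by (simp flip: exp_add)
  finally show ?thesis by (simp add: \<mu>_def)
qed

text \<open>The key inequality. On partitions of \<open>n\<close> the exponential of the scaled
  small-part size is a constant multiple of a tilted Boltzmann density, whose total mass is at most
  1. Jensen's inequality passes to the mean, and \<eta> may have either sign.\<close>

lemma mean_restricted_size_le:
  assumes n: "n \<ge> 1" and J: "J \<subseteq> {1..n}" and x: "x > 0" "\<eta> < x"
  shows "\<eta> * ((\<Sum>m\<in>partitions n. real (\<Sum>j\<in>J. j * m j)) / (real n * real (card (partitions n)))) * sqrt (real n)
     \<le> x * sqrt (real n) + bose_sum n x - ln (real (card (partitions n)))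
       + \<eta> * ((\<Sum>j\<in>J. real j / (exp ((x - \<eta>) * real j / sqrt (real n)) - 1)) / real n) * sqrt (real n)"
proof -
  define r where "r = sqrt (real n)"
  have r: "r > 0" "r * r = real n" using n by (auto simp: r_def)
  define p where "p = real (card (partitions n))"
  have p: "p > 0" by (simp add: p_def card_partitions_pos)
  define a where "a j = (x - (if j \<in> J then \<eta> else 0)) / r * real j" for j
  define X where "X m = real (\<Sum>j\<in>J. j * m j)" for m :: "nat \<Rightarrow> nat"
  define B where "B = (\<Sum>j=1..n. bose (a j))"
  have apos: "a j > 0" if "j \<in> {1..n}" for j using that x r by (auto simp: a_def)
  \<comment> \<open>The total size is \<open>n\<close> on all partitions, so the untilted part of
    the exponent is the constant \<open>x / r * n = x * r\<close>.\<close>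
  have "exp (\<eta> / r * X m) = exp (x * r + B) * pmf (boltzmann n a) m" if m: "m \<in> partitions n" for m
  proof -
    have z: "\<And>j. j \<notin> {1..n} \<Longrightarrow> m j = 0" and s: "(\<Sum>j=1..n. j * m j) = n"
      using m by (auto simp: partitions_def)
    have "(\<Sum>j=1..n. a j * real (m j)) =
        (\<Sum>j=1..n. x / r * real (j * m j) - (if j \<in> J then \<eta> / r * real (j * m j) else 0))"
      by (intro sum.cong) (auto simp: a_def algebra_simps diff_divide_distrib)
    also have "\<dots> = x / r * real (\<Sum>j=1..n. j * m j) - (\<Sum>j\<in>{1..n} \<inter> J. \<eta> / r * real (j * m j))"
      unfolding sum_subtractf of_nat_sum sum_distrib_left
      by (simp only: sum.inter_restrict finite_atLeastAtMost)
    also have "{1..n} \<inter> J = J" using J by blast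
    also have "(\<Sum>j\<in>J. \<eta> / r * real (j * m j)) = \<eta> / r * X m"
      by (simp only: X_def of_nat_sum sum_distrib_left)
    also have "x / r * real (\<Sum>j=1..n. j * m j) = x * r"
      unfolding s using r by (simp flip: r(2))
    finally show ?thesis
      using apos z by (subst pmf_boltzmann) (auto simp: B_def simp flip: exp_add)
  qed
  then have "(\<Sum>m\<in>partitions n. exp (\<eta> / r * X m)) = exp (x * r + B) * (\<Sum>m\<in>partitions n. pmf (boltzmann n a) m)"
    by (simp add: sum_distrib_left)
  also have "\<dots> \<le> exp (x * r + B) * 1"
    using measure_pmf.prob_le_1[of "boltzmann n a" "partitions n"]
    by (intro mult_left_mono) (auto simp: measure_measure_pmf_finite finite_partitions)
  finally have "p * exp ((\<Sum>m\<in>partitions n. \<eta> / r * X m) / p) \<le> exp (x * r + B)"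
    using jensen_exp_sum[OF finite_partitions[of n] partitions_nonempty, where g = "\<lambda>m. \<eta> / r * X m"]
    unfolding p_def by linarith
  then have "ln (p * exp ((\<Sum>m\<in>partitions n. \<eta> / r * X m) / p)) \<le> ln (exp (x * r + B))"
    using p by (intro ln_mono) auto
  then have 1: "ln p + (\<Sum>m\<in>partitions n. \<eta> / r * X m) / p \<le> x * r + B"
    using p by (simp add: ln_mult)
  have "B \<le> (\<Sum>j=1..n. bose (x / r * real j) + (if j \<in> J then \<eta> / r * (real j / (exp ((x - \<eta>) * real j / r) - 1)) else 0))"
    unfolding B_def
  proof (rule sum_mono)
    fix j assume j: "j \<in> {1..n}"
    show "bose (a j) \<le> bose (x / r * real j) + (if j \<in> J then \<eta> / r * (real j / (exp ((x - \<eta>) * real j / r) - 1)) else 0)"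
    proof (cases "j \<in> J")
      case True
      have aj: "a j = (x - \<eta>) * real j / r" using True by (simp add: a_def)
      \<comment> \<open>The tangent is taken at the tilted point \<open>a j\<close>, so the estimate
        is valid for both signs of \<eta>; this is why \<open>x - \<eta>\<close> appears in the
        sum.\<close>
      have "bose (a j) - bose (x / r * real j) \<le> (x / r * real j - a j) / (exp (a j) - 1)"
        using apos[OF j] j x r by (intro bose_diff_le) auto
      moreover have "x / r * real j - a j = \<eta> / r * real j"
        by (simp add: aj left_diff_distrib diff_divide_distrib)
      ultimately show ?thesis using True by (simp add: aj)
    qed (simp add: a_def)
  qed
  also have "\<dots> = bose_sum n x + (\<Sum>j\<in>{1..n} \<inter> J. \<eta> / r * (real j / (exp ((x - \<eta>) * real j / r) - 1)))"
    unfolding sum.distrib r_def sum_bose_scaled by (simp only: sum.inter_restrict finite_atLeastAtMost)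
  also have "{1..n} \<inter> J = J" using J by blast
  also have "(\<Sum>j\<in>J. \<eta> / r * (real j / (exp ((x - \<eta>) * real j / r) - 1)))
      = \<eta> / r * (\<Sum>j\<in>J. real j / (exp ((x - \<eta>) * real j / r) - 1))"
    by (simp only: sum_distrib_left)
  also have "\<dots> = \<eta> * ((\<Sum>j\<in>J. real j / (exp ((x - \<eta>) * real j / r) - 1)) / real n) * r"
    using r by (simp flip: r(2))
  finally have 2: "B \<le> bose_sum n x + \<eta> * ((\<Sum>j\<in>J. real j / (exp ((x - \<eta>) * real j / r) - 1)) / real n) * r" .
  have "(\<Sum>m\<in>partitions n. \<eta> / r * X m) / p = \<eta> * ((\<Sum>m\<in>partitions n. X m) / (real n * p)) * r"
    unfolding sum_distrib_left[symmetric] using r(1) p by (simp flip: r(2))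
  with 1 2 show ?thesis unfolding X_def p_def r_def by linarith
qed

theorem theorem3:
  fixes t :: real
  assumes "0 < t"
  shows "(\<lambda>n. measure_pmf.prob (procedure2 n)
            {\<omega>. pi * real (sigma2 \<omega>) / sqrt (6 * real n) \<le> t})
         \<longlonglongrightarrow> 6 / pi\<^sup>2 * integral {0..t} (\<lambda>u. u / (exp u - 1))"
proof -
  define c where "c = pi / sqrt 6"
  have c: "c > 0" "pi\<^sup>2 / 6 = c\<^sup>2" by (auto simp: c_def power_divide)
  define S where "S = t / c"
  have S: "S > 0" "c * S = t" using assms c by (auto simp: S_def)
  define E where "E n = measure_pmf.prob (procedure2 n)
            {\<omega>. pi * real (sigma2 \<omega>) / sqrt (6 * real n) \<le> t}" for n
  define J where "J n = {j. j \<in> {1..n} \<and> real j \<le> S * sqrt (real n)}" for n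
  define R where "R x n = (\<Sum>j\<in>J n. real j / (exp (x * real j / sqrt (real n)) - 1)) / real n" for x n
  define L where "L x = integral {0..x * S} bose_kernel / x\<^sup>2" for x
  \<comment> \<open>Only a one-sided estimate of this deficit is needed: \<open>e n\<close>
    eventually lies below every positive number.\<close>
  define e where "e n = 2 * c - ln (real (card (partitions n))) / sqrt (real n)" for n
  have R: "R x \<longlonglongrightarrow> L x" if "x > 0" for x
    using riemann_sum_asymp[OF that S(1)] by (simp add: R_def[abs_def] J_def L_def)
  have e: "eventually (\<lambda>n. e n < \<epsilon>) sequentially" if "\<epsilon> > 0" for \<epsilon>
  proof -
    have "2 * c - \<epsilon> < 2 * (pi / sqrt 6)" using that by (simp add: c_def)
    from card_partitions_lower_bound[OF this] show ?thesis
      using eventually_ge_at_top[of 1] by eventually_elim (simp add: e_def field_simps)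
  qed
  \<comment> \<open>At \<open>x = c\<close> the term \<open>bose_sum n c\<close> is at most
    \<open>c * sqrt n\<close>, so the leading terms add up to at most \<open>2 * c * sqrt n\<close>,
    which is the growth rate built into \<open>e\<close>.\<close>
  have main: "\<eta> * E n \<le> e n + \<eta> * R (c - \<eta>) n" if "n \<ge> 1" "\<eta> < c" for \<eta> n
  proof -
    have r: "sqrt (real n) > 0" using that by simp
    have "pi * real j / sqrt (6 * real n) \<le> t \<longleftrightarrow> real j \<le> S * sqrt (real n)" for j
      using r by (simp add: S_def c_def real_sqrt_mult field_simps)
    then have "E n = (\<Sum>m\<in>partitions n. real (\<Sum>j\<in>J n. j * m j)) / (real n * real (card (partitions n)))"
      using prob_procedure2[OF that(1), of "\<lambda>j. pi * real j / sqrt (6 * real n) \<le> t"]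
      by (simp add: E_def J_def)
    then have "\<eta> * E n * sqrt (real n) \<le> c * sqrt (real n) + bose_sum n c
        - ln (real (card (partitions n))) + \<eta> * R (c - \<eta>) n * sqrt (real n)"
      unfolding R_def using c that
      by (simp only:) (rule mean_restricted_size_le, auto simp: J_def)
    moreover have "bose_sum n c \<le> sqrt (real n) * c"
      using bose_sum_le[of c n] c that by (simp add: power2_eq_square)
    moreover have "e n * sqrt (real n) = 2 * c * sqrt (real n) - ln (real (card (partitions n)))"
      using r by (simp add: e_def algebra_simps)
    ultimately have "\<eta> * E n * sqrt (real n) \<le> (e n + \<eta> * R (c - \<eta>) n) * sqrt (real n)"
      by (simp add: algebra_simps)
    then show ?thesis using r by (simp add: mult_le_cancel_right)
  qed
  have "isCont (\<lambda>x. integral {0..x} bose_kernel) (c * S)"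
    using S assms by (intro isCont_integral_bose_kernel) auto
  then have "isCont L c"
    unfolding L_def using c by (intro continuous_intros isCont_o2[of _ "\<lambda>x. x * S" "\<lambda>x. integral {0..x} bose_kernel"]) auto
  then have L: "((\<lambda>\<eta>. L (c - \<eta>)) \<longlongrightarrow> L c) (at 0)"
    by (intro isCont_tendsto_compose[of c L]) (auto intro!: tendsto_eq_intros)
  have "E \<longlonglongrightarrow> L c"
  proof (rule order_tendstoI)
    fix a assume a: "L c < a"
    \<comment> \<open>The tilt \<eta> is fixed first, by continuity of \<open>L\<close>; only then
      does \<open>n\<close> tend to infinity.\<close>
    have "eventually (\<lambda>\<eta>. L (c - \<eta>) < a) (at_right 0)"
      using order_tendstoD(2)[OF L a] by (simp add: eventually_at_split)
    moreover have "eventually (\<lambda>\<eta>. \<eta> \<in> {0<..<c}) (at_right 0)"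
      using c by (intro eventually_at_right_real)
    ultimately have "eventually (\<lambda>\<eta>. L (c - \<eta>) < a \<and> \<eta> \<in> {0<..<c}) (at_right 0)"
      by (rule eventually_conj)
    from eventually_happens[OF this]
    obtain \<eta> where \<eta>: "L (c - \<eta>) < a" "\<eta> > 0" "\<eta> < c" by auto
    obtain b where b: "L (c - \<eta>) < b" "b < a" using dense[OF \<eta>(1)] by blast
    have "eventually (\<lambda>n. R (c - \<eta>) n < b) sequentially"
      using R[of "c - \<eta>"] b \<eta> by (intro order_tendstoD(2)) auto
    \<comment> \<open>The threshold is chosen so that adding \<eta> times \<open>b\<close> gives
      exactly \<eta> times \<open>a\<close>.\<close>
    moreover have "eventually (\<lambda>n. e n < \<eta> * (a - b)) sequentially"
      using \<eta> b by (intro e) auto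
    ultimately show "eventually (\<lambda>n. E n < a) sequentially"
      using eventually_ge_at_top[of 1]
    proof eventually_elim
      case (elim n)
      have "\<eta> * R (c - \<eta>) n < \<eta> * b" using elim \<eta> by simp
      with main[OF elim(3) \<eta>(3)] elim(2) have "\<eta> * E n < \<eta> * a"
        unfolding right_diff_distrib by linarith
      then show ?case using \<eta> by simp
    qed
  next
    fix a assume a: "a < L c"
    have "eventually (\<lambda>\<eta>. a < L (c - \<eta>)) (at_left 0)"
      using order_tendstoD(1)[OF L a] by (simp add: eventually_at_split)
    \<comment> \<open>The lower end -1 is arbitrary; what matters is that \<eta> is negative, so
      that dividing \<open>main\<close> by it reverses the inequality and bounds \<open>E n\<close>
      from below.\<close>
    moreover have "eventually (\<lambda>\<eta>. \<eta> \<in> {-1<..<0::real}) (at_left 0)"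
      by (intro eventually_at_left_real) auto
    ultimately have "eventually (\<lambda>\<eta>. a < L (c - \<eta>) \<and> \<eta> \<in> {-1<..<0}) (at_left 0)"
      by (rule eventually_conj)
    from eventually_happens[OF this]
    obtain \<eta> where \<eta>: "a < L (c - \<eta>)" "\<eta> < 0" by auto
    obtain b where b: "a < b" "b < L (c - \<eta>)" using dense[OF \<eta>(1)] by blast
    have "eventually (\<lambda>n. b < R (c - \<eta>) n) sequentially"
      using R[of "c - \<eta>"] b \<eta> c by (intro order_tendstoD(1)) auto
    \<comment> \<open>The threshold is positive, being a product of two negative factors.\<close>
    moreover have "eventually (\<lambda>n. e n < \<eta> * (a - b)) sequentially"
      using \<eta> b by (intro e mult_neg_neg) auto
    ultimately show "eventually (\<lambda>n. a < E n) sequentially"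
      using eventually_ge_at_top[of 1]
    proof eventually_elim
      case (elim n)
      have "\<eta> * R (c - \<eta>) n < \<eta> * b" using elim \<eta> by simp
      moreover have "\<eta> * E n \<le> e n + \<eta> * R (c - \<eta>) n"
        using elim(3) \<eta> c by (intro main) auto
      ultimately have "\<eta> * E n < \<eta> * a"
        using elim(2) unfolding right_diff_distrib by linarith
      then show ?case using \<eta> by (simp add: mult_less_cancel_left_neg)
    qed
  qed
  moreover have "L c = 6 / pi\<^sup>2 * integral {0..t} (\<lambda>u. u / (exp u - 1))"
    by (simp add: L_def S integral_bose_kernel flip: c(2))
  ultimately show ?thesis by (simp add: E_def[abs_def])
qed

end
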